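(* Let $G$ be an integer-weighted graph on $n$ vertices. Suppose $L(G)$ is diagonalisable by a Butson Hadamard matrix $H\in H(p,n)$ for some prime number $p$. If $L(G)$ has a non-zero integer eigenvalue $\lambda$, then (i) $\lambda$ is divisible by $p$; (ii) $\lambda$ has multiplicity at least $p-1$ as an eigenvalue of $L(G)$; and (iii) $G$ has an equitable partition with $p$ parts of equal size.
   Context: Graphs are simple (no loops, no multiple edges) and weighted with non-negative edge weights; integer-weighted means all edge weights are integers. The adjacency matrix $A(G)$ has $(i,j)$ entry equal to the weight of the edge $ij$ (zero if there is no edge), and $L(G)=D(G)-A(G)$, where $D(G)$ is the diagonal matrix of row sums of $A(G)$. $H(r,n)$ denotes the set of Butson Hadamard matrices: $n\times n$ matrices $H$ whose entries are all $r$-th roots of unity and which satisfy $HH^*=nI$. A matrix is diagonalisable by $H$ if every column of $H$ is an eigenvector of it (equivalently $H^{-1}L(G)H$ is diagonal). A partition of $V(G)$ into non-empty parts $V_1,\dots,V_m$ is equitable if for all $i,j\in\{1,\dots,m\}$ there is a constant $v_{i,j}$ such that, for every vertex $u\in V_i$, the sum of the weights of the edges joining $u$ to vertices of $V_j$ equals $v_{i,j}$. *)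

theory Defs
  imports
    "Jordan_Normal_Form.Char_Poly"
    "Jordan_Normal_Form.Schur_Decomposition"
    "HOL-Library.Disjoint_Sets"
    "HOL-Computational_Algebra.Primes"
begin

(* The vertices are 0, ..., n - 1, in accordance with the matrix indices. An edge is a
   two-element set of vertices; w is only meaningful on E. *)
locale weighted_graph =
  fixes n :: nat and E :: "nat set set" and w :: "nat set \<Rightarrow> real"
  assumes edges: "e \<in> E \<Longrightarrow> \<exists>u<n. \<exists>v<n. u \<noteq> v \<and> e = {u, v}"
    and weight_nonneg: "e \<in> E \<Longrightarrow> 0 \<le> w e"

locale integer_weighted_graph = weighted_graph +
  assumes weight_int: "e \<in> E \<Longrightarrow> w e \<in> \<int>"

(* The matrices are taken over the complex numbers so that they can be multiplied with
   Butson Hadamard matrices. *)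
definition adjacency_mat :: "nat \<Rightarrow> nat set set \<Rightarrow> (nat set \<Rightarrow> real) \<Rightarrow> complex mat" where
  "adjacency_mat n E w =
     mat n n (\<lambda>(i, j). if {i, j} \<in> E then complex_of_real (w {i, j}) else 0)"

definition degree_mat :: "nat \<Rightarrow> nat set set \<Rightarrow> (nat set \<Rightarrow> real) \<Rightarrow> complex mat" where
  "degree_mat n E w =
     mat n n (\<lambda>(i, j). if i = j then \<Sum>k<n. adjacency_mat n E w $$ (i, k) else 0)"

definition laplacian_mat :: "nat \<Rightarrow> nat set set \<Rightarrow> (nat set \<Rightarrow> real) \<Rightarrow> complex mat" where
  "laplacian_mat n E w = degree_mat n E w - adjacency_mat n E w"

definition butson_hadamard :: "nat \<Rightarrow> nat \<Rightarrow> complex mat set" where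
  "butson_hadamard r n =
     {H \<in> carrier_mat n n. (\<forall>i<n. \<forall>j<n. (H $$ (i, j)) ^ r = 1) \<and>
        H * mat_adjoint H = of_nat n \<cdot>\<^sub>m 1\<^sub>m n}"

definition diagonalisable_by :: "complex mat \<Rightarrow> complex mat \<Rightarrow> bool" where
  "diagonalisable_by M H \<longleftrightarrow> (\<forall>j<dim_col H. \<exists>\<mu>. eigenvector M (col H j) \<mu>)"

(* The summation ranges over the edges joining u to a vertex of W. *)
definition equitable_partition ::
    "nat \<Rightarrow> nat set set \<Rightarrow> (nat set \<Rightarrow> real) \<Rightarrow> nat set set \<Rightarrow> bool" where
  "equitable_partition n E w P \<longleftrightarrow> partition_on {0..<n} P \<and>
     (\<forall>V\<in>P. \<forall>W\<in>P. \<exists>c. \<forall>u\<in>V. (\<Sum>e\<in>{e \<in> E. \<exists>v\<in>W. e = {u, v}}. w e) = c)"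

end

theory Submission
  imports Defs
begin

text \<open>
  Let \<open>z\<close> be a primitive \<open>p\<close>-th root of unity and write an eigenvector column of \<open>H\<close>
  for \<open>\<lambda>\<close> as \<open>(z^(a v))\<^sub>v\<close>. Every row of the eigenvector equation is an integer relation
  between powers of \<open>z\<close>, so, the cyclotomic polynomial being irreducible, all its coefficients
  agree: the sum of row \<open>u\<close> of \<open>L - \<lambda>I\<close> over each fibre of \<open>a\<close> is \<open>-\<lambda>/p\<close>. This
  gives the divisibility, and also the equitable partition into the fibres of \<open>a\<close> as soon as
  \<open>G\<close> is regular, which holds because the diagonal of \<open>L = (1/n) H D H\<^sup>*\<close> is constant when
  the entries of \<open>H\<close> are unimodular. The fibres have equal size since the eigenvector is
  orthogonal to the all-ones vector. Finally, \<open>z\<close> may be replaced by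
  \<open>z^2, \<dots>, z^(p-1)\<close> in the relations, which produces \<open>p - 1\<close> orthogonal eigenvectors.
\<close>

subsection \<open>Integer relations between roots of unity of prime order\<close>

text \<open>Let \<open>i\<close> be least with \<open>p\<close> not dividing coefficient
  \<open>i\<close> of \<open>g\<close>. In coefficient \<open>i\<close> of \<open>f * g\<close>
  every summand except \<open>coeff f 0 * coeff g i\<close> involves a lower coefficient of
  \<open>g\<close>, so \<open>p\<close> does not divide the total. By \<open>low\<close> this can
  only be the leading coefficient, whence deg(fg) \<le> i \<le> deg g.\<close>

lemma eisenstein_aux:
  fixes f g :: "int poly" and p :: int
  assumes p: "prime p" and lead: "\<not> p dvd lead_coeff (f * g)"
    and low: "\<And>i. i < degree (f * g) \<Longrightarrow> p dvd coeff (f * g) i"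
    and f0: "\<not> p dvd coeff f 0"
  shows "degree f = 0"
proof -
  have "f * g \<noteq> 0" using lead by auto
  hence nz: "f \<noteq> 0" "g \<noteq> 0" by auto
  have "\<not> p dvd coeff g (degree g)" using lead by (auto simp: lead_coeff_mult)
  hence ex: "\<exists>i. \<not> p dvd coeff g i" by blast
  define i where "i = (LEAST i. \<not> p dvd coeff g i)"
  have i: "\<not> p dvd coeff g i" unfolding i_def using ex by (rule LeastI_ex)
  have less: "p dvd coeff g j" if "j < i" for j
    using not_less_Least that unfolding i_def by blast
  have "coeff (f * g) i = coeff f 0 * coeff g i + (\<Sum>j\<in>{..i} - {0}. coeff f j * coeff g (i - j))"
    unfolding coeff_mult by (subst sum.remove[of _ 0]) auto
  moreover have "p dvd (\<Sum>j\<in>{..i} - {0}. coeff f j * coeff g (i - j))"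
    by (rule dvd_sum) (auto intro!: dvd_mult less)
  moreover have "\<not> p dvd coeff f 0 * coeff g i"
    using p f0 i by (simp add: prime_dvd_mult_iff)
  ultimately have "\<not> p dvd coeff (f * g) i" by (simp add: dvd_add_left_iff)
  hence "degree (f * g) \<le> i" using low by (meson not_le)
  moreover have "i \<le> degree g"
    by (rule le_degree) (use i in auto)
  ultimately show ?thesis using nz by (simp add: degree_mult_eq)
qed

text \<open>If \<open>p\<close> divided both constant coefficients, its square would divide their
  product; the one-sided version therefore applies to one of the two factors.\<close>

lemma eisenstein:
  fixes f g :: "int poly" and p :: int
  assumes p: "prime p" and lead: "\<not> p dvd lead_coeff (f * g)"
    and low: "\<And>i. i < degree (f * g) \<Longrightarrow> p dvd coeff (f * g) i"
    and sq: "\<not> p\<^sup>2 dvd coeff (f * g) 0"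
  shows "degree f = 0 \<or> degree g = 0"
proof -
  have "\<not> p dvd coeff f 0 \<or> \<not> p dvd coeff g 0"
    using sq by (auto simp: power2_eq_square mult_dvd_mono coeff_mult)
  thus ?thesis
    using eisenstein_aux[of p f g] eisenstein_aux[of p g f] assms by (auto simp: mult.commute)
qed

text \<open>For prime \<open>p\<close> this is \<open>\<Phi>\<^sub>p(1 + x) = ((1 + x)^p - 1) / x\<close>, to which Eisenstein's criterion applies.\<close>

definition shifted_cyclotomic :: "nat \<Rightarrow> int poly" where
  "shifted_cyclotomic p = (\<Sum>k<p. monom (of_nat (p choose Suc k)) k)"

lemma coeff_shifted_cyclotomic:
  "coeff (shifted_cyclotomic p) k = (if k < p then int (p choose Suc k) else 0)"
  unfolding shifted_cyclotomic_def by (simp add: coeff_sum coeff_monom if_distrib)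

lemma degree_shifted_cyclotomic:
  assumes "p > 0"
  shows "degree (shifted_cyclotomic p) = p - 1"
proof (rule antisym)
  show "degree (shifted_cyclotomic p) \<le> p - 1"
    by (rule degree_le) (use assms in \<open>auto simp: coeff_shifted_cyclotomic\<close>)
  show "p - 1 \<le> degree (shifted_cyclotomic p)"
    by (rule le_degree) (use assms in \<open>auto simp: coeff_shifted_cyclotomic\<close>)
qed

lemma lead_coeff_shifted_cyclotomic:
  assumes "p > 0"
  shows "lead_coeff (shifted_cyclotomic p) = 1"
  using assms by (simp add: degree_shifted_cyclotomic coeff_shifted_cyclotomic)

text \<open>Expand \<open>z ^ p = ((z - 1) + 1) ^ p\<close> binomially: the constant term cancels
  against \<open>z ^ p = 1\<close>, and a non-zero factor \<open>z - 1\<close> can then be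
  removed.\<close>

lemma shifted_cyclotomic_root:
  fixes z :: complex
  assumes "z ^ p = 1" "z \<noteq> 1"
  shows "poly (of_int_poly (shifted_cyclotomic p)) (z - 1) = 0"
proof -
  have "(\<Sum>k<p. of_nat (p choose Suc k) * (z - 1) ^ Suc k) + 1 = ((z - 1) + 1) ^ p"
    by (subst binomial_ring) (simp add: lessThan_Suc_atMost[symmetric] sum.lessThan_Suc_shift del: sum.lessThan_Suc)
  hence "(z - 1) * (\<Sum>k<p. of_nat (p choose Suc k) * (z - 1) ^ k) = 0"
    using assms(1) by (simp add: sum_distrib_left algebra_simps)
  moreover have "poly (of_int_poly (shifted_cyclotomic p)) (z - 1)
      = (\<Sum>k<p. of_nat (p choose Suc k) * (z - 1) ^ k)"
    unfolding shifted_cyclotomic_def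
    by (simp add: of_int_poly_hom.hom_sum poly_sum poly_monom map_poly_monom)
  ultimately show ?thesis using assms(2) by simp
qed

text \<open>The constant coefficient is p itself, the leading one is 1, and p divides every other
  binomial coefficient in between.\<close>

lemma shifted_cyclotomic_factor:
  assumes p: "prime p" and fg: "shifted_cyclotomic p = f * g"
  shows "degree f = 0 \<or> degree g = 0"
proof (rule eisenstein)
  have p0: "p > 0" using p prime_gt_0_nat by blast
  show "prime (int p)" using p by simp
  show "\<not> int p dvd lead_coeff (f * g)"
    unfolding fg[symmetric] lead_coeff_shifted_cyclotomic[OF p0] using p by auto
  show "int p dvd coeff (f * g) i" if "i < degree (f * g)" for i
    using that p unfolding fg[symmetric] degree_shifted_cyclotomic[OF p0]
    by (auto simp: coeff_shifted_cyclotomic intro!: dvd_choose_prime)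
  show "\<not> (int p)\<^sup>2 dvd coeff (f * g) 0"
    unfolding fg[symmetric] using p p0 prime_gt_1_nat[OF p]
    by (auto simp: coeff_shifted_cyclotomic power2_eq_square dest: zdvd_imp_le)
qed

text \<open>Among the non-zero integer polynomials vanishing at \<open>x\<close>, one of least
  degree has a primitive part that divides the shifted cyclotomic polynomial, by pseudo-division and
  Gauss's lemma. Its degree lies below p - 1, so irreducibility makes it constant, and a non-zero
  constant has no root.\<close>

lemma shifted_cyclotomic_minimal:
  fixes x :: complex
  assumes p: "prime p" and root: "poly (of_int_poly (shifted_cyclotomic p)) x = 0"
    and f: "poly (of_int_poly f) x = 0" "degree f < p - 1"
  shows "f = 0"
proof (rule ccontr)
  have p0: "p > 0" using p prime_gt_0_nat by blast
  let ?E = "shifted_cyclotomic p"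
  define P where "P g \<longleftrightarrow> g \<noteq> 0 \<and> poly (of_int_poly g) x = 0" for g :: "int poly"
  assume "f \<noteq> 0"
  hence "P f" using f by (simp add: P_def)
  then obtain g where g: "P g" and min: "\<And>h. P h \<Longrightarrow> degree g \<le> degree h"
    using ex_has_least_nat[of P f degree] by blast
  have dg: "degree g < p - 1" using min[OF \<open>P f\<close>] f(2) by linarith
  define h where "h = primitive_part g"
  have gh: "g = smult (content g) h" by (simp add: h_def)
  have hx: "poly (of_int_poly h) x = 0"
    using g arg_cong[OF gh, of "\<lambda>f. poly (of_int_poly f) x"]
    by (auto simp: P_def of_int_hom.map_poly_hom_smult)
  have h0: "h \<noteq> 0" and ch: "content h = 1" and dh: "degree h = degree g"
    using g by (auto simp: h_def P_def)
  obtain a q where a: "a \<noteq> 0" and q: "smult a ?E = h * q + pseudo_mod ?E h"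
    using pseudo_mod(1)[OF h0, of ?E] by blast
  have "poly (of_int_poly (smult a ?E)) x = poly (of_int_poly (h * q + pseudo_mod ?E h)) x"
    by (simp add: q)
  hence "poly (of_int_poly (pseudo_mod ?E h)) x = 0"
    using root hx by (simp add: hom_distribs)
  \<comment> \<open>A non-zero remainder would vanish at \<open>x\<close> with degree below the
    least possible.\<close>
  hence r: "pseudo_mod ?E h = 0"
    using pseudo_mod(2)[OF h0, of ?E] min[of "pseudo_mod ?E h"] dh
    unfolding P_def by (metis not_le)
  hence eq: "smult a ?E = h * q" using q by simp
  have E0: "?E \<noteq> 0" using lead_coeff_shifted_cyclotomic[OF p0] by auto
  have "content ?E dvd lead_coeff ?E" by (rule content_dvd_coeff)
  hence cE: "content ?E = 1"
    unfolding lead_coeff_shifted_cyclotomic[OF p0] by (metis is_unit_content_iff normalize_content is_unit_normalize)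
  \<comment> \<open>Gauss's lemma: \<open>h\<close> and the monic \<open>?E\<close> are primitive,
    so passing to primitive parts leaves only the sign of \<open>a\<close>, which squares to
    1.\<close>
  have "smult (unit_factor a) (primitive_part ?E) = h * primitive_part q"
    using arg_cong[OF eq, of primitive_part]
    by (simp add: primitive_part_smult primitive_part_mult primitive_part_prim[OF ch])
  hence "smult (unit_factor a) ?E = h * primitive_part q"
    by (simp add: primitive_part_prim[OF cE])
  hence "smult (unit_factor a * unit_factor a) ?E = h * smult (unit_factor a) (primitive_part q)"
    by (metis mult_smult_right smult_smult)
  moreover have "unit_factor a * unit_factor a = 1" using a by (simp add: sgn_if)
  ultimately have "?E = h * smult (unit_factor a) (primitive_part q)" by simp
  moreover from this have "degree ?E = degree h + degree (smult (unit_factor a) (primitive_part q))"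
    using E0 by (metis degree_mult_eq mult_zero_left mult_zero_right)
  ultimately have "degree h = 0"
    using shifted_cyclotomic_factor[OF p] degree_shifted_cyclotomic[OF p0] dg dh by fastforce
  then obtain c where "h = [:c:]" by (rule degree_eq_zeroE)
  thus False using hx h0 by simp
qed

text \<open>Subtracting \<open>c (p - 1)\<close> times the vanishing geometric sum removes the top
  power of \<open>z\<close>. What remains is an integer polynomial of degree at most p - 2 with root
  \<open>z\<close>; shifted by 1, it falls under the minimality result and is zero.\<close>

lemma prime_root_relation:
  fixes z :: complex and c :: "nat \<Rightarrow> int"
  assumes p: "prime p" and z: "z ^ p = 1" "z \<noteq> 1"
    and rel: "(\<Sum>k<p. of_int (c k) * z ^ k) = 0" and k: "k < p"
  shows "c k = c (p - 1)"
proof -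
  have p0: "p > 0" using p prime_gt_0_nat by blast
  define f where "f = (\<Sum>k<p - 1. monom (c k - c (p - 1)) k)"
  have cf: "coeff f k = (if k < p - 1 then c k - c (p - 1) else 0)" for k
    unfolding f_def by (simp add: coeff_sum coeff_monom if_distrib)
  have geom: "(\<Sum>k<p. z ^ k) = 0" using z by (simp add: geometric_sum)
  have "poly (of_int_poly f) z = (\<Sum>k<p - 1. of_int (c k - c (p - 1)) * z ^ k)"
    unfolding f_def by (simp add: of_int_poly_hom.hom_sum poly_sum poly_monom map_poly_monom)
  also have "\<dots> = (\<Sum>k<p. of_int (c k - c (p - 1)) * z ^ k)"
    using p0 by (cases p) auto
  also have "\<dots> = (\<Sum>k<p. of_int (c k) * z ^ k) - of_int (c (p - 1)) * (\<Sum>k<p. z ^ k)"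
    by (simp add: left_diff_distrib sum_subtractf sum_distrib_left)
  finally have fz: "poly (of_int_poly f) z = 0" using rel geom by simp
  have "degree f \<le> p - 2"
    by (rule degree_le) (auto simp: cf)
  hence "degree (f \<circ>\<^sub>p [:1, 1:]) < p - 1"
    using prime_ge_2_nat[OF p] by (simp add: degree_pcompose)
  moreover have "poly (of_int_poly (f \<circ>\<^sub>p [:1, 1:])) (z - 1) = 0"
    using fz by (simp add: of_int_hom.map_poly_pcompose poly_pcompose)
  ultimately have "f \<circ>\<^sub>p [:1, 1:] = 0"
    using shifted_cyclotomic_minimal[OF p shifted_cyclotomic_root[OF z]] by blast
  hence "f = 0" by (simp add: pcompose_eq_0_iff)
  thus ?thesis using cf[of k] k by (cases "k < p - 1") (auto simp: not_less intro: arg_cong[of _ _ c])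
qed

section \<open>Relations grouped by the fibres of the exponent function\<close>

lemma sum_powers_fibres:
  fixes g :: "'a \<Rightarrow> 'b :: comm_semiring_1" and a :: "'a \<Rightarrow> nat"
  assumes "finite A" "a ` A \<subseteq> {..<p}"
  shows "(\<Sum>v\<in>A. g v * z ^ a v) = (\<Sum>k<p. (\<Sum>v\<in>{v \<in> A. a v = k}. g v) * z ^ k)"
proof -
  have "(\<Sum>v\<in>A. g v * z ^ a v) = (\<Sum>k<p. \<Sum>v\<in>{v \<in> A. a v = k}. g v * z ^ a v)"
    by (rule sum.group[symmetric]) (use assms in auto)
  also have "\<dots> = (\<Sum>k<p. (\<Sum>v\<in>{v \<in> A. a v = k}. g v) * z ^ k)"
    by (simp add: sum_distrib_right)
  finally show ?thesis .
qed

text \<open>After grouping equal exponents, the p fibre sums are the coefficients of a relation,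
  hence all equal, and each is a p-th of the total.\<close>

lemma prime_root_fibre_sum:
  fixes z :: complex and g :: "'a \<Rightarrow> int"
  assumes p: "prime p" and z: "z ^ p = 1" "z \<noteq> 1"
    and A: "finite A" "a ` A \<subseteq> {..<p}"
    and rel: "(\<Sum>v\<in>A. of_int (g v) * z ^ a v) = 0" and k: "k < p"
  shows "int p * (\<Sum>v\<in>{v \<in> A. a v = k}. g v) = (\<Sum>v\<in>A. g v)"
proof -
  define c where "c k = (\<Sum>v\<in>{v \<in> A. a v = k}. g v)" for k
  have "(\<Sum>k<p. of_int (c k) * z ^ k) = 0"
    using rel sum_powers_fibres[OF A, of "\<lambda>v. of_int (g v)" z] by (simp add: c_def)
  hence eq: "c l = c (p - 1)" if "l < p" for l
    using prime_root_relation[OF p z] that by blast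
  \<comment> \<open>The grouping identity with base 1 gives the total.\<close>
  have "(\<Sum>v\<in>A. g v) = (\<Sum>l<p. c l)"
    using sum_powers_fibres[OF A, of g 1] by (simp add: c_def)
  also have "\<dots> = (\<Sum>l<p. c k)"
    by (intro sum.cong refl) (metis eq k lessThan_iff)
  finally show ?thesis by (simp add: c_def)
qed

text \<open>Takes the place of a Galois automorphism sending \<open>z\<close> to \<open>y\<close>:
  the fibre sums are constant, so at \<open>y\<close> the relation is a multiple of a geometric sum,
  which vanishes.\<close>

lemma prime_root_conjugate_relation:
  fixes z y :: complex and g :: "'a \<Rightarrow> int"
  assumes p: "prime p" and z: "z ^ p = 1" "z \<noteq> 1" and y: "y ^ p = 1" "y \<noteq> 1"
    and A: "finite A" "a ` A \<subseteq> {..<p}"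
    and rel: "(\<Sum>v\<in>A. of_int (g v) * z ^ a v) = 0"
  shows "(\<Sum>v\<in>A. of_int (g v) * y ^ a v) = 0"
proof -
  have "of_nat p * (\<Sum>v\<in>A. of_int (g v) * y ^ a v)
      = (\<Sum>k<p. of_int (int p * (\<Sum>v\<in>{v \<in> A. a v = k}. g v)) * y ^ k)"
    using sum_powers_fibres[OF A, of "\<lambda>v. of_int (g v)" y]
    by (simp add: sum_distrib_left[where A = "{..<p}"] mult.assoc)
  also have "\<dots> = of_int (\<Sum>v\<in>A. g v) * (\<Sum>k<p. y ^ k)"
    unfolding sum_distrib_left[where A = "{..<p}"]
    by (intro sum.cong refl) (simp only: lessThan_iff prime_root_fibre_sum[OF p z A rel])
  also have "\<dots> = 0" using y by (simp add: geometric_sum)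
  finally show ?thesis using p by auto
qed

lemma card_fibre_prime_root:
  fixes z :: complex
  assumes "prime p" "z ^ p = 1" "z \<noteq> 1" "finite A" "a ` A \<subseteq> {..<p}"
    and "(\<Sum>v\<in>A. z ^ a v) = 0" "k < p"
  shows "p * card {v \<in> A. a v = k} = card A"
  using prime_root_fibre_sum[of p z A a "\<lambda>_. 1" k] assms
  by (simp flip: of_nat_mult)

lemma primitive_root_powers:
  assumes "p > 0"
  defines "z \<equiv> cis (2 * pi / real p)"
  shows "z ^ p = 1" "inj_on (\<lambda>k. z ^ k) {..<p}" "\<And>x. x ^ p = 1 \<Longrightarrow> \<exists>k<p. x = z ^ k"
proof -
  have pow: "z ^ k = cis (2 * pi * real k / real p)" for k
    unfolding z_def by (simp add: DeMoivre mult_ac)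
  have bij: "bij_betw (\<lambda>k. z ^ k) {..<p} {x. x ^ p = 1}"
    unfolding pow by (rule bij_betw_roots_unity[OF assms(1)])
  show "z ^ p = 1" using assms(1) unfolding pow by simp
  show "inj_on (\<lambda>k. z ^ k) {..<p}" using bij by (rule bij_betw_imp_inj_on)
  show "\<exists>k<p. x = z ^ k" if "x ^ p = 1" for x
    using bij_betw_imp_surj_on[OF bij] that by (auto simp: set_eq_iff image_iff)
qed

subsection \<open>Matrices diagonalised by a multiple of a unitary matrix\<close>

text \<open>With \<open>z\<close> being \<open>N\<close> times the orthogonal projection of
  \<open>y\<close> to the span of the family, the squared norm of \<open>N y - z\<close> expands to
  \<open>N * (N * Y - T)\<close>, which is therefore non-negative.\<close>

lemma bessel_inequality:
  fixes x :: "'i \<Rightarrow> 'a \<Rightarrow> complex" and y :: "'a \<Rightarrow> complex" and N :: real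
  assumes fin: "finite U" "finite M" and N: "N > 0"
    and orth: "\<And>m m'. m \<in> M \<Longrightarrow> m' \<in> M \<Longrightarrow>
      (\<Sum>u\<in>U. x m u * cnj (x m' u)) = (if m = m' then of_real N else 0)"
  shows "(\<Sum>m\<in>M. (cmod (\<Sum>u\<in>U. y u * cnj (x m u)))\<^sup>2) \<le> N * (\<Sum>u\<in>U. (cmod (y u))\<^sup>2)"
proof -
  define t where "t m = (\<Sum>u\<in>U. y u * cnj (x m u))" for m
  define z where "z u = (\<Sum>m\<in>M. t m * x m u)" for u
  define T where "T = (\<Sum>m\<in>M. (cmod (t m))\<^sup>2)"
  define Y where "Y = (\<Sum>u\<in>U. (cmod (y u))\<^sup>2)"
  have sqn: "complex_of_real ((cmod a)\<^sup>2) = a * cnj a" for a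
    by (rule complex_norm_square)
  have T: "complex_of_real T = (\<Sum>m\<in>M. t m * cnj (t m))"
    by (simp only: T_def of_real_sum sqn)
  have Y: "complex_of_real Y = (\<Sum>u\<in>U. y u * cnj (y u))"
    by (simp only: Y_def of_real_sum sqn)
  have yz: "(\<Sum>u\<in>U. y u * cnj (z u)) = of_real T"
  proof -
    have "(\<Sum>u\<in>U. y u * cnj (z u)) = (\<Sum>u\<in>U. \<Sum>m\<in>M. y u * cnj (x m u) * cnj (t m))"
      by (simp add: z_def sum_distrib_left mult_ac)
    also have "\<dots> = (\<Sum>m\<in>M. t m * cnj (t m))"
      by (subst sum.swap) (simp add: t_def sum_distrib_right)
    finally show ?thesis by (simp add: T)
  qed
  have zy: "(\<Sum>u\<in>U. z u * cnj (y u)) = of_real T"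
    using arg_cong[OF yz, of cnj] by (simp add: mult_ac)
  have zz: "(\<Sum>u\<in>U. z u * cnj (z u)) = of_real N * of_real T"
  proof -
    have "(\<Sum>u\<in>U. z u * cnj (z u))
        = (\<Sum>u\<in>U. \<Sum>m\<in>M. \<Sum>m'\<in>M. t m * cnj (t m') * (x m u * cnj (x m' u)))"
      unfolding z_def cnj_sum sum_product by (simp add: mult_ac)
    also have "\<dots> = (\<Sum>m\<in>M. \<Sum>u\<in>U. \<Sum>m'\<in>M. t m * cnj (t m') * (x m u * cnj (x m' u)))"
      by (rule sum.swap)
    also have "\<dots> = (\<Sum>m\<in>M. \<Sum>m'\<in>M. \<Sum>u\<in>U. t m * cnj (t m') * (x m u * cnj (x m' u)))"
      by (rule sum.cong[OF refl], rule sum.swap)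
    also have "\<dots> = (\<Sum>m\<in>M. \<Sum>m'\<in>M. t m * cnj (t m') * (if m = m' then of_real N else 0))"
      by (intro sum.cong refl) (simp add: sum_distrib_left[symmetric] orth)
    also have "\<dots> = (\<Sum>m\<in>M. t m * cnj (t m) * of_real N)"
      using fin by (intro sum.cong refl) (simp add: if_distrib cong: if_cong)
    finally show ?thesis by (simp add: T sum_distrib_left mult_ac)
  qed
  have "complex_of_real (\<Sum>u\<in>U. (cmod (of_real N * y u - z u))\<^sup>2)
      = (\<Sum>u\<in>U. (of_real N * y u - z u) * cnj (of_real N * y u - z u))"
    by (simp only: of_real_sum sqn)
  also have "\<dots> = of_real N * of_real N * (\<Sum>u\<in>U. y u * cnj (y u))
      - of_real N * (\<Sum>u\<in>U. y u * cnj (z u)) - of_real N * (\<Sum>u\<in>U. z u * cnj (y u))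
      + (\<Sum>u\<in>U. z u * cnj (z u))"
    by (simp add: sum_distrib_left sum.distrib[symmetric] sum_subtractf[symmetric] algebra_simps)
  also have "\<dots> = of_real (N * (N * Y - T))"
    unfolding yz zy zz Y[symmetric] by (simp add: algebra_simps)
  finally have "(\<Sum>u\<in>U. (cmod (of_real N * y u - z u))\<^sup>2) = N * (N * Y - T)"
    by (simp only: of_real_eq_iff)
  moreover have "0 \<le> (\<Sum>u\<in>U. (cmod (of_real N * y u - z u))\<^sup>2)"
    by (rule sum_nonneg) simp
  ultimately have "T \<le> N * Y" using N by (simp add: zero_le_mult_iff)
  thus ?thesis by (simp only: T_def Y_def t_def)
qed

lemma order_prod_linear:
  fixes f :: "'i \<Rightarrow> 'a :: idom"
  assumes "finite S"
  shows "order a (\<Prod>j\<in>S. [:- f j, 1:]) = card {j \<in> S. f j = a}"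
  using assms
proof (induction rule: finite_induct)
  case (insert i S)
  have "{j \<in> insert i S. f j = a} = (if f i = a then insert i {j \<in> S. f j = a} else {j \<in> S. f j = a})"
    by auto
  moreover have "order a [:- f i, 1:] = (if f i = a then 1 else 0)"
    using order_power_n_n[of a 1] by (auto intro: order_0I)
  moreover have "[:- f i, 1:] * (\<Prod>j\<in>S. [:- f j, 1:]) \<noteq> 0"
    using insert by (simp del: mult_pCons_left)
  ultimately show ?case using insert by (simp add: order_mult del: mult_pCons_left)
qed simp

lemma mat_adjoint_carrier:
  "A \<in> carrier_mat n m \<Longrightarrow> mat_adjoint A \<in> carrier_mat m n"
  unfolding mat_adjoint_def by (auto simp: mat_of_rows_def)

lemma mat_adjoint_index:
  assumes "A \<in> carrier_mat n m" "i < m" "j < n"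
  shows "mat_adjoint A $$ (i, j) = conjugate (A $$ (j, i))"
  using assms unfolding mat_adjoint_def by (auto simp: mat_of_rows_def)

lemma mat_mult_index_sum:
  assumes "A \<in> carrier_mat n m" "B \<in> carrier_mat m k" "i < n" "j < k"
  shows "(A * B) $$ (i, j) = (\<Sum>l<m. A $$ (i, l) * B $$ (l, j))"
  using assms by (auto simp: scalar_prod_def atLeast0LessThan)

text \<open>\<open>H\<close> divided by the square root of \<open>N\<close> is unitary; carrying the
  scale along avoids square roots. Butson Hadamard matrices enter with N = n.\<close>

locale scaled_unitary =
  fixes n :: nat and N :: real and H :: "complex mat"
  assumes H: "H \<in> carrier_mat n n" and N: "N > 0"
    and HH: "H * mat_adjoint H = of_real N \<cdot>\<^sub>m 1\<^sub>m n"
begin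

definition Hinv :: "complex mat" where
  "Hinv = of_real (1 / N) \<cdot>\<^sub>m mat_adjoint H"

lemma Hinv: "Hinv \<in> carrier_mat n n"
  unfolding Hinv_def using mat_adjoint_carrier[OF H] by simp

lemma H_Hinv: "H * Hinv = 1\<^sub>m n"
proof -
  have "H * Hinv = of_real (1 / N) \<cdot>\<^sub>m (of_real N \<cdot>\<^sub>m 1\<^sub>m n)"
    unfolding Hinv_def HH[symmetric]
    by (rule mult_smult_distrib[OF H mat_adjoint_carrier[OF H]])
  thus ?thesis using N by (intro eq_matI) auto
qed

lemma Hinv_H: "Hinv * H = 1\<^sub>m n"
  by (rule mat_mult_left_right_inverse[OF H Hinv H_Hinv])

lemma Hinv_index: "i < n \<Longrightarrow> j < n \<Longrightarrow> Hinv $$ (i, j) = cnj (H $$ (j, i)) / of_real N"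
  unfolding Hinv_def using H mat_adjoint_carrier[OF H] by (simp add: mat_adjoint_index)

lemma rows_orthogonal:
  assumes "u < n" "v < n"
  shows "(\<Sum>j<n. H $$ (u, j) * cnj (H $$ (v, j))) = (if u = v then of_real N else 0)"
proof -
  have "(\<Sum>j<n. H $$ (u, j) * cnj (H $$ (v, j))) = of_real N * (H * Hinv) $$ (u, v)"
    unfolding mat_mult_index_sum[OF H Hinv assms] sum_distrib_left
    using assms N by (intro sum.cong refl) (simp add: Hinv_index)
  thus ?thesis using assms by (simp add: H_Hinv)
qed

text \<open>Expand the squares and sum over the columns first; orthogonality of the rows leaves only
  the terms with u = v.\<close>

lemma parseval:
  fixes x :: "nat \<Rightarrow> complex"
  shows "(\<Sum>j<n. (cmod (\<Sum>u<n. x u * cnj (H $$ (u, j))))\<^sup>2) = N * (\<Sum>u<n. (cmod (x u))\<^sup>2)"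
proof -
  have "complex_of_real (\<Sum>j<n. (cmod (\<Sum>u<n. x u * cnj (H $$ (u, j))))\<^sup>2)
      = (\<Sum>j<n. \<Sum>u<n. \<Sum>v<n. x u * cnj (x v) * (H $$ (v, j) * cnj (H $$ (u, j))))"
    unfolding of_real_sum complex_norm_square cnj_sum sum_product by (simp add: mult_ac)
  also have "\<dots> = (\<Sum>u<n. \<Sum>j<n. \<Sum>v<n. x u * cnj (x v) * (H $$ (v, j) * cnj (H $$ (u, j))))"
    by (rule sum.swap)
  also have "\<dots> = (\<Sum>u<n. \<Sum>v<n. \<Sum>j<n. x u * cnj (x v) * (H $$ (v, j) * cnj (H $$ (u, j))))"
    by (rule sum.cong[OF refl], rule sum.swap)
  also have "\<dots> = (\<Sum>u<n. \<Sum>v<n. x u * cnj (x v) * (if v = u then of_real N else 0))"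
    by (intro sum.cong refl) (simp add: sum_distrib_left[symmetric] rows_orthogonal)
  also have "\<dots> = (\<Sum>u<n. x u * cnj (x u) * of_real N)"
    by (intro sum.cong refl) (simp add: if_distrib cong: if_cong)
  also have "\<dots> = of_real (N * (\<Sum>u<n. (cmod (x u))\<^sup>2))"
    by (simp only: of_real_mult of_real_sum complex_norm_square sum_distrib_left mult_ac)
  finally show ?thesis by (simp only: of_real_eq_iff)
qed

section \<open>Spectrum of a matrix having the columns of \<open>H\<close> as eigenvectors\<close>

context
  fixes L :: "complex mat" and mu :: "nat \<Rightarrow> complex"
  assumes L: "L \<in> carrier_mat n n"
    and eig: "\<And>j. j < n \<Longrightarrow> L *\<^sub>v col H j = mu j \<cdot>\<^sub>v col H j"
begin

lemma eigen_index:
  assumes "u < n" "j < n"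
  shows "(\<Sum>v<n. L $$ (u, v) * H $$ (v, j)) = mu j * H $$ (u, j)"
  using arg_cong[OF eig[OF assms(2)], of "\<lambda>x. x $ u"] assms L H
  by (simp add: scalar_prod_def atLeast0LessThan)

lemma diagonalisation:
  "L = H * mat n n (\<lambda>(i, j). if i = j then mu j else 0) * Hinv"
proof -
  define D where "D = mat n n (\<lambda>(i, j). if i = j then mu j else 0)"
  have D: "D \<in> carrier_mat n n" by (simp add: D_def)
  have "L * H = H * D"
  proof (rule eq_matI)
    fix u j assume "u < dim_row (H * D)" "j < dim_col (H * D)"
    hence uj: "u < n" "j < n" using H D by auto
    have "(H * D) $$ (u, j) = (\<Sum>l<n. if l = j then mu j * H $$ (u, j) else 0)"
      unfolding mat_mult_index_sum[OF H D uj] using uj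
      by (intro sum.cong) (auto simp: D_def)
    thus "(L * H) $$ (u, j) = (H * D) $$ (u, j)"
      using uj by (simp add: mat_mult_index_sum[OF L H uj] eigen_index)
  qed (use L H D in auto)
  hence "H * D * Hinv = L * (H * Hinv)" using assoc_mult_mat[OF L H Hinv] by simp
  thus ?thesis using L by (simp add: H_Hinv D_def)
qed

text \<open>\<open>L\<close> is similar to the diagonal matrix of the \<open>mu j\<close>, so
  algebraic multiplicity becomes a count of columns.\<close>

lemma order_char_poly_eq:
  "order a (char_poly L) = card {j \<in> {..<n}. mu j = a}"
proof -
  define D where "D = mat n n (\<lambda>(i, j). if i = j then mu j else 0)"
  have D: "D \<in> carrier_mat n n" by (simp add: D_def)
  have "similar_mat L D"
    by (rule similar_matI[of _ _ H Hinv n])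
      (use L D H Hinv H_Hinv Hinv_H diagonalisation in \<open>auto simp: D_def\<close>)
  hence "char_poly L = char_poly D" by (rule char_poly_similar)
  also have "\<dots> = (\<Prod>a\<leftarrow>diag_mat D. [:- a, 1:])"
    by (rule char_poly_upper_triangular[OF D]) (auto simp: D_def)
  also have "diag_mat D = map mu [0..<n]"
    by (auto simp: diag_mat_def D_def intro!: nth_equalityI)
  also have "(\<Prod>a\<leftarrow>map mu [0..<n]. [:- a, 1:]) = (\<Prod>j<n. [:- mu j, 1:])"
    by (simp add: prod.distinct_set_conv_list[symmetric] o_def atLeast0LessThan)
  finally show ?thesis by (simp add: order_prod_linear)
qed

lemma eigenvalueE:
  assumes "eigenvalue L a"
  obtains j where "j < n" "mu j = a"
proof -
  have "order a (char_poly L) \<noteq> 0"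
    using assms eigenvalue_root_char_poly[OF L, of a] degree_monic_char_poly[OF L]
    by (auto simp: order_root)
  hence "{j \<in> {..<n}. mu j = a} \<noteq> {}" unfolding order_char_poly_eq by (metis card.empty)
  thus ?thesis using that by auto
qed

text \<open>Multiply row \<open>u\<close> of the j-th eigenvector equation by the conjugate of
  \<open>H $$ (u, j)\<close> and sum over j: unimodularity leaves \<open>mu j\<close> on one side,
  and row orthogonality isolates \<open>L $$ (u, u)\<close> on the other. The value does not depend
  on \<open>u\<close>, which later forces the graph to be regular.\<close>

lemma diagonal_const:
  assumes unimod: "\<And>j. j < n \<Longrightarrow> cmod (H $$ (u, j)) = 1" and u: "u < n"
  shows "L $$ (u, u) = (\<Sum>j<n. mu j) / of_real N"
proof -
  have "(\<Sum>j<n. mu j) = (\<Sum>j<n. \<Sum>v<n. L $$ (u, v) * (H $$ (v, j) * cnj (H $$ (u, j))))"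
  proof (rule sum.cong[OF refl])
    fix j assume "j \<in> {..<n}"
    hence j: "j < n" by simp
    have "mu j = mu j * (H $$ (u, j) * cnj (H $$ (u, j)))"
      using unimod[OF j] by (simp add: complex_norm_square[symmetric])
    also have "\<dots> = (\<Sum>v<n. L $$ (u, v) * H $$ (v, j)) * cnj (H $$ (u, j))"
      by (simp add: eigen_index[OF u j])
    finally show "mu j = (\<Sum>v<n. L $$ (u, v) * (H $$ (v, j) * cnj (H $$ (u, j))))"
      by (simp add: sum_distrib_right mult.assoc)
  qed
  also have "\<dots> = (\<Sum>v<n. L $$ (u, v) * (\<Sum>j<n. H $$ (v, j) * cnj (H $$ (u, j))))"
    by (subst sum.swap) (simp add: sum_distrib_left)
  also have "\<dots> = L $$ (u, u) * of_real N"
    using u by (simp add: rows_orthogonal if_distrib cong: if_cong)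
  finally show ?thesis using N by simp
qed

text \<open>Bessel's inequality for the family \<open>x\<close> bounds the weight that each column of
  \<open>H\<close> can carry, whereas by Parseval all the weight of \<open>x\<close> lies on the
  columns with eigenvalue \<open>a\<close>.\<close>

lemma multiplicity_ge_orthogonal_family:
  fixes x :: "'i \<Rightarrow> nat \<Rightarrow> complex" and a :: real
  assumes fin: "finite M" and unimod: "\<And>u j. u < n \<Longrightarrow> j < n \<Longrightarrow> cmod (H $$ (u, j)) = 1"
    and herm: "\<And>u v. u < n \<Longrightarrow> v < n \<Longrightarrow> cnj (L $$ (u, v)) = L $$ (v, u)"
    and ev: "\<And>m u. m \<in> M \<Longrightarrow> u < n \<Longrightarrow> (\<Sum>v<n. L $$ (u, v) * x m v) = of_real a * x m u"
    and orth: "\<And>m m'. m \<in> M \<Longrightarrow> m' \<in> M \<Longrightarrow>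
      (\<Sum>u<n. x m u * cnj (x m' u)) = (if m = m' then of_nat n else 0)"
    and n: "n > 0"
  shows "card M \<le> order (of_real a) (char_poly L)"
proof -
  define S where "S = {j \<in> {..<n}. mu j = of_real a}"
  define t where "t m j = (\<Sum>u<n. x m u * cnj (H $$ (u, j)))" for m j
  \<comment> \<open>Eigenvectors of a Hermitian matrix for different eigenvalues are orthogonal.
    Moving \<open>L\<close> across the inner product yields the conjugate of \<open>mu j\<close>,
    which still differs from \<open>a\<close> because \<open>a\<close> is real.\<close>
  have t0: "t m j = 0" if m: "m \<in> M" and j: "j < n" and ne: "mu j \<noteq> of_real a" for m j
  proof -
    have "of_real a * t m j = (\<Sum>u<n. (of_real a * x m u) * cnj (H $$ (u, j)))"
      by (simp add: t_def sum_distrib_left mult_ac)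
    also have "\<dots> = (\<Sum>u<n. \<Sum>v<n. L $$ (u, v) * x m v * cnj (H $$ (u, j)))"
      by (intro sum.cong refl) (simp add: ev[OF m, symmetric] sum_distrib_right)
    also have "\<dots> = (\<Sum>v<n. \<Sum>u<n. L $$ (u, v) * x m v * cnj (H $$ (u, j)))"
      by (rule sum.swap)
    also have "\<dots> = (\<Sum>v<n. x m v * cnj (\<Sum>u<n. L $$ (v, u) * H $$ (u, j)))"
      unfolding cnj_sum sum_distrib_left
      by (intro sum.cong refl) (simp add: herm mult_ac)
    also have "\<dots> = (\<Sum>v<n. x m v * cnj (mu j * H $$ (v, j)))"
      using j by (intro sum.cong refl) (simp add: eigen_index)
    also have "\<dots> = cnj (mu j) * t m j"
      by (simp add: t_def sum_distrib_left mult_ac)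
    finally have "t m j = 0 \<or> of_real a = cnj (mu j)" by simp
    moreover have "of_real a \<noteq> cnj (mu j)"
      using ne by (metis complex_cnj_cnj complex_cnj_complex_of_real)
    ultimately show ?thesis by blast
  qed
  have xn: "(\<Sum>u<n. (cmod (x m u))\<^sup>2) = n" if "m \<in> M" for m
  proof -
    have "complex_of_real (\<Sum>u<n. (cmod (x m u))\<^sup>2) = of_real (real n)"
      unfolding of_real_sum complex_norm_square using orth[OF that that] by simp
    thus ?thesis by (simp only: of_real_eq_iff)
  qed
  have bessel: "(\<Sum>m\<in>M. (cmod (t m j))\<^sup>2) \<le> n * n" if "j < n" for j
  proof -
    have "(\<Sum>m\<in>M. (cmod (\<Sum>u<n. H $$ (u, j) * cnj (x m u)))\<^sup>2)
        \<le> real n * (\<Sum>u<n. (cmod (H $$ (u, j)))\<^sup>2)"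
      by (rule bessel_inequality) (use fin orth n in auto)
    moreover have "cmod (\<Sum>u<n. H $$ (u, j) * cnj (x m u)) = cmod (t m j)" for m
      unfolding t_def
      by (subst complex_mod_cnj[symmetric]) (simp add: mult_ac)
    ultimately show ?thesis using that by (simp add: unimod)
  qed
  have Nn: "N = n"
  proof -
    have "complex_of_real N = (\<Sum>j<n. H $$ (0, j) * cnj (H $$ (0, j)))"
      using rows_orthogonal[of 0 0] n by simp
    also have "\<dots> = of_real (real n)"
      using n by (simp add: unimod complex_norm_square[symmetric])
    finally show ?thesis by (simp only: of_real_eq_iff)
  qed
  \<comment> \<open>Double counting: each member of the family has total weight n^2, all of it on
    columns in \<open>S\<close>, and each such column carries at most n^2.\<close>
  have "real (card M) * (n * n) = (\<Sum>m\<in>M. N * (\<Sum>u<n. (cmod (x m u))\<^sup>2))"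
    by (simp add: xn Nn)
  also have "\<dots> = (\<Sum>m\<in>M. \<Sum>j<n. (cmod (t m j))\<^sup>2)"
    by (simp add: parseval[symmetric] t_def)
  also have "\<dots> = (\<Sum>m\<in>M. \<Sum>j\<in>S. (cmod (t m j))\<^sup>2)"
    by (intro sum.cong refl sum.mono_neutral_right) (auto simp: S_def t0)
  also have "\<dots> = (\<Sum>j\<in>S. \<Sum>m\<in>M. (cmod (t m j))\<^sup>2)"
    by (rule sum.swap)
  also have "\<dots> \<le> (\<Sum>j\<in>S. real (n * n))"
    by (rule sum_mono) (use bessel in \<open>auto simp: S_def\<close>)
  also have "\<dots> = real (card S) * (n * n)" by simp
  finally have "card M \<le> card S" using n by simp
  thus ?thesis by (simp add: order_char_poly_eq S_def)
qed

end

end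

subsection \<open>Laplacians\<close>

context weighted_graph
begin

text \<open>A real counterpart of the complex adjacency entries, in which integrality and edge sums
  are handled.\<close>

definition adj :: "nat \<Rightarrow> nat \<Rightarrow> real" where
  "adj u v = (if {u, v} \<in> E then w {u, v} else 0)"

definition deg :: "nat \<Rightarrow> real" where
  "deg u = (\<Sum>v<n. adj u v)"

lemma adj_sym: "adj u v = adj v u"
  by (simp add: adj_def insert_commute)

lemma no_loop: "{u, u} \<notin> E"
  using edges[of "{u, u}"] by (auto simp: doubleton_eq_iff)

lemma adj_diag: "adj u u = 0"
  using no_loop by (simp add: adj_def)

lemma laplacian_carrier: "laplacian_mat n E w \<in> carrier_mat n n"
  by (auto simp: laplacian_mat_def degree_mat_def adjacency_mat_def)

lemma laplacian_index:
  "u < n \<Longrightarrow> v < n \<Longrightarrow>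
    laplacian_mat n E w $$ (u, v) = complex_of_real ((if u = v then deg u else 0) - adj u v)"
  by (auto simp: laplacian_mat_def degree_mat_def adjacency_mat_def deg_def adj_def intro!: sum.cong)

lemma laplacian_row_sum:
  "u < n \<Longrightarrow> (\<Sum>v<n. laplacian_mat n E w $$ (u, v)) = 0"
  by (simp add: laplacian_index deg_def sum_subtractf flip: of_real_sum)

lemma laplacian_sym:
  "u < n \<Longrightarrow> v < n \<Longrightarrow> laplacian_mat n E w $$ (u, v) = laplacian_mat n E w $$ (v, u)"
  by (simp add: laplacian_index adj_sym[of u v])

text \<open>By symmetry the columns of the Laplacian sum to zero as its rows do, so adding up all
  rows of the eigenvector equation leaves \<open>a\<close> times the sum of \<open>h\<close> equal
  to 0.\<close>

lemma laplacian_eigenvector_sum: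
  assumes ev: "\<And>u. u < n \<Longrightarrow> (\<Sum>v<n. laplacian_mat n E w $$ (u, v) * h v) = a * h u"
    and "a \<noteq> 0"
  shows "(\<Sum>v<n. h v) = 0"
proof -
  have "a * (\<Sum>u<n. h u) = (\<Sum>u<n. \<Sum>v<n. laplacian_mat n E w $$ (u, v) * h v)"
    by (simp add: sum_distrib_left ev)
  also have "\<dots> = (\<Sum>v<n. \<Sum>u<n. laplacian_mat n E w $$ (v, u) * h v)"
    by (subst sum.swap, intro sum.cong refl) (simp add: laplacian_sym)
  also have "\<dots> = 0"
    by (simp add: laplacian_row_sum flip: sum_distrib_right)
  finally show ?thesis using \<open>a \<noteq> 0\<close> by simp
qed

text \<open>For fixed \<open>u\<close> the map from v to {u, v} is injective, so the edge sum in
  \<open>equitable_partition\<close> can be reindexed by vertices.\<close>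

lemma edge_weight_sum:
  assumes "finite W"
  shows "(\<Sum>e\<in>{e \<in> E. \<exists>v\<in>W. e = {u, v}}. w e) = (\<Sum>v\<in>W. adj u v)"
proof -
  have "{e \<in> E. \<exists>v\<in>W. e = {u, v}} = (\<lambda>v. {u, v}) ` {v \<in> W. {u, v} \<in> E}" by auto
  moreover have "inj_on (\<lambda>v. {u, v}) {v \<in> W. {u, v} \<in> E}"
    by (auto simp: inj_on_def doubleton_eq_iff)
  ultimately have "(\<Sum>e\<in>{e \<in> E. \<exists>v\<in>W. e = {u, v}}. w e) = (\<Sum>v\<in>{v \<in> W. {u, v} \<in> E}. w {u, v})"
    by (simp add: sum.reindex)
  also have "\<dots> = (\<Sum>v\<in>W. adj u v)"
    using assms by (simp add: adj_def sum.inter_filter)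
  finally show ?thesis .
qed

end

theorem theorem3p3:
  fixes n p :: nat and E :: "nat set set" and w :: "nat set \<Rightarrow> real"
    and H :: "complex mat" and lam :: int
  assumes "integer_weighted_graph n E w"
    and "prime p"
    and "H \<in> butson_hadamard p n"
    and "diagonalisable_by (laplacian_mat n E w) H"
    and "eigenvalue (laplacian_mat n E w) (of_int lam)"
    and "lam \<noteq> 0"
  shows "int p dvd lam \<and>
    order (of_int lam) (char_poly (laplacian_mat n E w)) \<ge> p - 1 \<and>
    (\<exists>P. equitable_partition n E w P \<and> card P = p \<and> (\<forall>V\<in>P. \<forall>W\<in>P. card V = card W))"
proof -
  interpret integer_weighted_graph n E w by fact
  define L where "L = laplacian_mat n E w"
  have L: "L \<in> carrier_mat n n" unfolding L_def by (rule laplacian_carrier)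
  have p: "prime p" and p0: "p > 0" using assms(2) prime_gt_0_nat by auto
  have n: "n > 0" using eigenvalue_imp_nonzero_dim[OF L] assms(5) L_def by blast
  have H: "H \<in> carrier_mat n n" "H * mat_adjoint H = of_nat n \<cdot>\<^sub>m 1\<^sub>m n"
    and Hp: "\<And>i j. i < n \<Longrightarrow> j < n \<Longrightarrow> (H $$ (i, j)) ^ p = 1"
    using assms(3) by (auto simp: butson_hadamard_def)
  interpret scaled_unitary n "real n" H
    by unfold_locales (use H n in auto)
  have unit: "cmod x = 1" if "x ^ p = 1" for x :: complex
    using that p0 by (metis norm_ge_zero norm_one norm_power power_eq_imp_eq_base power_one zero_le_one)
  have "\<forall>j. \<exists>\<mu>. j < n \<longrightarrow> eigenvector L (col H j) \<mu>"
    using assms(4) H by (auto simp: diagonalisable_by_def L_def)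
  then obtain mu where "\<And>j. j < n \<Longrightarrow> eigenvector L (col H j) (mu j)" by metis
  hence eig: "\<And>j. j < n \<Longrightarrow> L *\<^sub>v col H j = mu j \<cdot>\<^sub>v col H j"
    by (simp add: eigenvector_def)
  \<comment> \<open>The eigenvector for \<open>lam\<close> is taken to be a column of
    \<open>H\<close>, so that its entries are powers of one root of unity.\<close>
  obtain j where j: "j < n" "mu j = of_int lam"
    using eigenvalueE[OF L eig] assms(5) unfolding L_def by blast

  define z where "z = cis (2 * pi / real p)"
  note zp = primitive_root_powers[OF p0, folded z_def]
  have pow_ne: "z ^ k \<noteq> z ^ l" if "k < p" "l < p" "k \<noteq> l" for k l
    using inj_onD[OF zp(2)] that by auto
  have z: "z ^ p = 1" "z \<noteq> 1"
    using zp(1) pow_ne[of 1 0] prime_gt_1_nat[OF p] by auto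
  have "\<forall>v. \<exists>k. v < n \<longrightarrow> k < p \<and> H $$ (v, j) = z ^ k"
    using zp(3) Hp[OF _ j(1)] by blast
  then obtain a where a: "\<And>v. v < n \<Longrightarrow> a v < p" and Ha: "\<And>v. v < n \<Longrightarrow> H $$ (v, j) = z ^ a v"
    by metis
  have A: "finite {..<n}" "a ` {..<n} \<subseteq> {..<p}" using a by auto
  have ev: "(\<Sum>v<n. L $$ (u, v) * z ^ a v) = of_int lam * z ^ a u" if "u < n" for u
    using eigen_index[OF L eig that j(1)] that by (simp add: Ha j(2))
  have sum0: "(\<Sum>v<n. z ^ a v) = 0"
    by (rule laplacian_eigenvector_sum[folded L_def, OF ev]) (use assms(6) in auto)

  \<comment> \<open>The entries are already integers; the floor only moves them to type
    \<open>int\<close>.\<close>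
  define l where "l u v = \<lfloor>(if u = v then deg u else 0) - adj u v\<rfloor>" for u v
  have "adj u v \<in> \<int>" for u v using weight_int by (simp add: adj_def)
  hence "(if u = v then deg u else 0) - adj u v \<in> \<int>" for u v
    by (auto simp: deg_def intro!: Ints_diff Ints_sum)
  hence l: "real_of_int (l u v) = (if u = v then deg u else 0) - adj u v" for u v
    unfolding l_def by (metis Ints_cases floor_of_int)
  have Ll: "L $$ (u, v) = of_int (l u v)" if "u < n" "v < n" for u v
    unfolding L_def laplacian_index[OF that] l[symmetric] by simp
  \<comment> \<open>Row \<open>u\<close> of L - lam I, whose product with the eigenvector is an
    integer relation between powers of \<open>z\<close>.\<close>
  define g where "g u v = l u v - (if v = u then lam else 0)" for u v
  have g: "(\<Sum>v<n. of_int (g u v) * f v) = (\<Sum>v<n. L $$ (u, v) * f v) - of_int lam * f u"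
    if "u < n" for u and f :: "nat \<Rightarrow> complex"
    using that
    by (simp add: g_def Ll left_diff_distrib sum_subtractf if_distrib[of of_int] if_distribR
        if_distrib[of "\<lambda>x. x * _"] cong: if_cong)
  have rel: "(\<Sum>v<n. of_int (g u v) * z ^ a v) = 0" if "u < n" for u
    using g[OF that] ev[OF that] by simp
  have gsum: "(\<Sum>v<n. g u v) = - lam" if "u < n" for u
  proof -
    have "complex_of_int (\<Sum>v<n. g u v) = of_int (- lam)"
      using g[OF that, of "\<lambda>_. 1"] laplacian_row_sum[OF that] by (simp add: L_def)
    thus ?thesis by (simp only: of_int_eq_iff)
  qed
  define V where "V k = {v \<in> {..<n}. a v = k}" for k
  have fibre: "int p * (\<Sum>v\<in>V k. g u v) = - lam" if "u < n" "k < p" for u k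
    using prime_root_fibre_sum[OF p z A rel[OF that(1)] that(2)] gsum[OF that(1)]
    by (simp add: V_def)

  have "int p dvd lam"
    using fibre[OF n p0] by (metis dvd_minus_iff dvd_triv_left)
  \<comment> \<open>The p - 1 vectors arise from the chosen column by replacing \<open>z\<close>
    with \<open>z ^ m\<close>; each is an eigenvector for \<open>lam\<close> because the row
    relations survive conjugation.\<close>
  moreover have "card {1..<p} \<le> order (of_real (of_int lam)) (char_poly L)"
  proof (rule multiplicity_ge_orthogonal_family[OF L eig, where x = "\<lambda>m v. (z ^ m) ^ a v"])
    have root: "(z ^ m) ^ p = 1" for m by (metis mult.commute power_mult power_one z(1))
    show "(\<Sum>v<n. L $$ (u, v) * (z ^ m) ^ a v) = of_real (of_int lam) * (z ^ m) ^ a u"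
      if "m \<in> {1..<p}" "u < n" for m u
      using prime_root_conjugate_relation[OF p z root[of m] _ A rel[OF that(2)]]
        pow_ne[of m 0] that g[OF that(2)] by simp
    show "(\<Sum>u<n. (z ^ m) ^ a u * cnj ((z ^ m') ^ a u)) = (if m = m' then of_nat n else 0)"
      if m: "m \<in> {1..<p}" "m' \<in> {1..<p}" for m m'
    proof (cases "m = m'")
      case True
      have "(z ^ m) ^ a u * cnj ((z ^ m) ^ a u) = 1" for u
        by (simp add: complex_norm_square[symmetric] norm_power unit[OF z(1)] del: complex_cnj_power)
      thus ?thesis using True by simp
    next
      case False
      \<comment> \<open>The inner product of the vectors for m and m' is the sum of the
        \<open>y ^ a u\<close>. Since \<open>y\<close> is a p-th root of unity other than 1, this is
        a conjugate of \<open>sum0\<close>.\<close>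
      define y where "y = z ^ m * cnj (z ^ m')"
      have "y ^ p = 1" unfolding y_def by (simp only: power_mult_distrib root flip: complex_cnj_power) simp
      moreover have "y \<noteq> 1"
      proof
        assume "y = 1"
        hence "z ^ m * (z ^ m' * cnj (z ^ m')) = z ^ m'"
          unfolding y_def by (metis mult.assoc mult.commute mult.right_neutral)
        moreover have "z ^ m' * cnj (z ^ m') = 1"
          by (simp add: complex_norm_square[symmetric] norm_power unit[OF z(1)] del: complex_cnj_power)
        ultimately have "z ^ m = z ^ m'" by (simp only: mult_1_right)
        thus False using pow_ne[of m m'] m False by simp
      qed
      ultimately have "(\<Sum>u<n. y ^ a u) = 0"
        using prime_root_conjugate_relation[OF p z _ _ A, of y "\<lambda>_. 1"] sum0 by simp
      thus ?thesis using False by (simp add: y_def power_mult_distrib)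
    qed
    show "cnj (L $$ (u, v)) = L $$ (v, u)" if "u < n" "v < n" for u v
      using that laplacian_sym[OF that] by (simp add: L_def laplacian_index)
  qed (use n Hp unit in auto)
  moreover have "\<exists>P. equitable_partition n E w P \<and> card P = p \<and> (\<forall>V\<in>P. \<forall>W\<in>P. card V = card W)"
  proof (intro exI conjI)
    have card: "p * card (V k) = n" if "k < p" for k
      using card_fibre_prime_root[OF p z A sum0 that] by (simp add: V_def)
    have ne: "V k \<noteq> {}" if "k < p" for k
      using card[OF that] n by auto
    \<comment> \<open>Distinct fibres are disjoint and non-empty, so they differ as sets and there
      are exactly p parts.\<close>
    have inj: "inj_on V {..<p}"
      by (rule inj_onI) (use ne in \<open>force simp: V_def\<close>)
    show "card (V ` {..<p}) = p" using inj by (simp add: card_image)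
    show "\<forall>A\<in>V ` {..<p}. \<forall>B\<in>V ` {..<p}. card A = card B"
    proof safe
      fix k k' assume "k < p" "k' < p"
      hence "p * card (V k) = p * card (V k')" by (simp add: card)
      thus "card (V k) = card (V k')" using p0 by simp
    qed
    define d where "d = deg 0"
    have deg: "deg u = d" if "u < n" for u
    proof -
      have "L $$ (u, u) = L $$ (0, 0)"
        using diagonal_const[OF L eig] Hp unit that n by metis
      thus ?thesis using that n by (simp add: L_def laplacian_index adj_diag d_def)
    qed
    \<comment> \<open>Solve the fibre identity for the adjacency sum: over \<open>V k'\<close>, row
      \<open>u\<close> of L - lam I sums to -lam/p, and its diagonal entry d - lam occurs exactly
      when k = k'. Only k and k' enter, by regularity.\<close>
    have adj_sum: "(\<Sum>v\<in>V k'. adj u v) = (if k = k' then d - of_int lam else 0) + of_int lam / p"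
      if u: "u \<in> V k" and k': "k' < p" for u k k'
    proof -
      have un: "u < n" using u by (simp add: V_def)
      have mem: "u \<in> V k' \<longleftrightarrow> k = k'" using u by (auto simp: V_def)
      have fin: "finite (V k')" by (simp add: V_def)
      have "real_of_int (\<Sum>v\<in>V k'. g u v) = (if k = k' then d - of_int lam else 0) - (\<Sum>v\<in>V k'. adj u v)"
        using fin deg[OF un]
        by (simp add: g_def l sum_subtractf if_distrib[of of_int] mem cong: if_cong)
      moreover have "real_of_int (\<Sum>v\<in>V k'. g u v) = - (of_int lam / p)"
        using arg_cong[OF fibre[OF un k'], of real_of_int] p0
        by (simp add: field_simps del: of_int_sum)
      ultimately show ?thesis by linarith
    qed
    show "equitable_partition n E w (V ` {..<p})"
      unfolding equitable_partition_def
    proof (intro conjI ballI)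
      show "partition_on {0..<n} (V ` {..<p})"
      proof (rule partition_onI)
        show "\<Union> (V ` {..<p}) = {0..<n}" using a by (auto simp: V_def)
        show "disjnt A B" if "A \<in> V ` {..<p}" "B \<in> V ` {..<p}" "A \<noteq> B" for A B
          using that by (auto simp: V_def disjnt_def)
      qed (use ne in auto)
      fix A B assume "A \<in> V ` {..<p}" "B \<in> V ` {..<p}"
      then obtain k k' where "A = V k" "B = V k'" "k' < p" by auto
      moreover have "finite (V k')" by (simp add: V_def)
      ultimately show "\<exists>c. \<forall>u\<in>A. (\<Sum>e\<in>{e \<in> E. \<exists>v\<in>B. e = {u, v}}. w e) = c"
        by (auto simp: edge_weight_sum adj_sum)
    qed
  qed
  ultimately show ?thesis by (simp add: L_def)
qed

end
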